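(* Let $\varphi\in S(\mathbb{D})$ and $g\in H^\infty(\mathbb{D})$. Then $C_\varphi$ and $I_g$ are essentially commutative on $\mathcal{B}$, i.e. $C_\varphi I_g-I_gC_\varphi:\mathcal{B}\to\mathcal{B}$ is compact, if and only if $$\lim_{|\varphi(z)|\to1}|\varphi^\#(z)|\,|g(\varphi(z))-g(z)|=0.$$
   Context: $\mathbb{D}$ is the open unit disk in $\mathbb{C}$, $H(\mathbb{D})$ is the set of holomorphic functions on $\mathbb{D}$, $H^\infty(\mathbb{D})$ the bounded ones, and $S(\mathbb{D})$ is the set of holomorphic maps $\mathbb{D}\to\mathbb{D}$. For $\varphi\in S(\mathbb{D})$, $C_\varphi f=f\circ\varphi$ and $\varphi^\#(z)=\frac{1-|z|^2}{1-|\varphi(z)|^2}\varphi'(z)$. For $g,f\in H(\mathbb{D})$, $I_gf(z)=\int_0^z f'(\zeta)g(\zeta)\,d\zeta$. The Bloch space $\mathcal{B}$ is the set of $f\in H(\mathbb{D})$ with $\|f\|_*=\sup_{z\in\mathbb{D}}(1-|z|^2)|f'(z)|<\infty$, a Banach space with norm $|f(0)|+\|f\|_*$. The notation $\lim_{|\varphi(z)|\to1}F(z)=0$ means: for every $\varepsilon>0$ there is $r\in(0,1)$ such that $|F(z)|<\varepsilon$ whenever $z\in\mathbb{D}$ and $|\varphi(z)|>r$ (vacuously true if $\sup_{\mathbb{D}}|\varphi|<1$). *)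

theory Defs
  imports "HOL-Complex_Analysis.Complex_Analysis"
begin

abbreviation unit_disk :: "complex set" ("\<D>")
  where "\<D> \<equiv> ball 0 1"

definition disk_selfmaps :: "(complex \<Rightarrow> complex) set"
  where "disk_selfmaps = {\<phi>. \<phi> holomorphic_on \<D> \<and> \<phi> ` \<D> \<subseteq> \<D>}"

definition H_infinity :: "(complex \<Rightarrow> complex) set"
  where "H_infinity = {g. g holomorphic_on \<D> \<and> bounded (g ` \<D>)}"

definition bloch_weight :: "(complex \<Rightarrow> complex) \<Rightarrow> complex \<Rightarrow> real"
  where "bloch_weight f z = (1 - (cmod z)\<^sup>2) * cmod (deriv f z)"

text \<open>HOL functions are total, so a function on the disk is represented by its extension by
  zero. Hence two elements of the Bloch space are equal iff they agree on the disk,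
  and the norm below separates points.\<close>

definition bloch :: "(complex \<Rightarrow> complex) set"
  where "bloch = {f. f holomorphic_on \<D> \<and> (\<forall>z. z \<notin> \<D> \<longrightarrow> f z = 0) \<and>
                     bdd_above (bloch_weight f ` \<D>)}"

definition bloch_seminorm :: "(complex \<Rightarrow> complex) \<Rightarrow> real"
  where "bloch_seminorm f = (SUP z\<in>\<D>. bloch_weight f z)"

definition bloch_norm :: "(complex \<Rightarrow> complex) \<Rightarrow> real"
  where "bloch_norm f = cmod (f 0) + bloch_seminorm f"

text \<open>The value \<open>0\<close> outside the carrier is junk; it is there because the locale
  \<open>Metric_space\<close> requires nonnegativity and symmetry everywhere.\<close>

definition bloch_dist :: "(complex \<Rightarrow> complex) \<Rightarrow> (complex \<Rightarrow> complex) \<Rightarrow> real"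
  where "bloch_dist f h = (if f \<in> bloch \<and> h \<in> bloch then bloch_norm (\<lambda>z. f z - h z) else 0)"

lemma deriv_diff_bloch:
  assumes "f \<in> bloch" "h \<in> bloch" "z \<in> \<D>"
  shows "deriv (\<lambda>z. f z - h z) z = deriv f z - deriv h z"
  using assms unfolding bloch_def
  by (intro deriv_diff) (auto intro: holomorphic_on_imp_differentiable_at)

lemma one_minus_norm_sq_pos: "z \<in> \<D> \<Longrightarrow> 0 < 1 - (cmod z)\<^sup>2"
  by (simp add: power_less_one_iff abs_square_less_1)

lemma bloch_weight_le_seminorm:
  "f \<in> bloch \<Longrightarrow> z \<in> \<D> \<Longrightarrow> bloch_weight f z \<le> bloch_seminorm f"
  unfolding bloch_seminorm_def bloch_def by (auto intro!: cSUP_upper)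

lemma bloch_weight_nonneg: "z \<in> \<D> \<Longrightarrow> 0 \<le> bloch_weight f z"
  unfolding bloch_weight_def using one_minus_norm_sq_pos[of z] by simp

lemma bloch_weight_diff_le:
  assumes "f \<in> bloch" "h \<in> bloch" "z \<in> \<D>"
  shows "bloch_weight (\<lambda>z. f z - h z) z \<le> bloch_weight f z + bloch_weight h z"
proof -
  have "(1 - (cmod z)\<^sup>2) * cmod (deriv f z - deriv h z)
      \<le> (1 - (cmod z)\<^sup>2) * (cmod (deriv f z) + cmod (deriv h z))"
    using one_minus_norm_sq_pos[OF assms(3)] by (intro mult_left_mono norm_triangle_ineq4) auto
  then show ?thesis
    by (simp add: bloch_weight_def deriv_diff_bloch[OF assms] distrib_left)
qed

lemma bloch_diff:
  assumes "f \<in> bloch" "h \<in> bloch"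
  shows "(\<lambda>z. f z - h z) \<in> bloch"
proof -
  have "bloch_weight (\<lambda>z. f z - h z) z \<le> bloch_seminorm f + bloch_seminorm h" if "z \<in> \<D>" for z
    using bloch_weight_diff_le[OF assms that] bloch_weight_le_seminorm[OF assms(1) that]
      bloch_weight_le_seminorm[OF assms(2) that] by linarith
  then have "bdd_above (bloch_weight (\<lambda>z. f z - h z) ` \<D>)"
    by (intro bdd_aboveI2) auto
  then show ?thesis
    using assms unfolding bloch_def by (auto intro: holomorphic_on_diff)
qed

lemma bloch_seminorm_nonneg: "f \<in> bloch \<Longrightarrow> 0 \<le> bloch_seminorm f"
  using bloch_weight_le_seminorm[of f 0] bloch_weight_nonneg[of 0 f] by simp

lemma bloch_norm_eq_0_D:
  assumes f: "f \<in> bloch" and "bloch_norm f = 0"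
  shows "f z = 0"
proof (cases "z \<in> \<D>")
  case True
  have 0: "f 0 = 0" "bloch_seminorm f = 0"
    using assms bloch_seminorm_nonneg[OF f]
    by (simp_all add: bloch_norm_def add_nonneg_eq_0_iff)
  have d: "deriv f w = 0" if "w \<in> \<D>" for w
  proof -
    have "bloch_weight f w = 0"
      using bloch_weight_le_seminorm[OF f that] bloch_weight_nonneg[OF that, of f] 0 by simp
    then show ?thesis
      using one_minus_norm_sq_pos[OF that] by (auto simp: bloch_weight_def)
  qed
  have "(f has_field_derivative 0) (at w)" if "w \<in> \<D>" for w
    using d[OF that] f that holomorphic_derivI[of f \<D> w] by (auto simp: bloch_def)
  then have "f constant_on \<D>"
    by (intro has_field_derivative_0_imp_constant_on) auto
  then show ?thesis
    using 0 True unfolding constant_on_def by (metis centre_in_ball zero_less_one)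
qed (use f in \<open>auto simp: bloch_def\<close>)

lemma bloch_dist_commute: "bloch_dist f h = bloch_dist h f"
proof (cases "f \<in> bloch \<and> h \<in> bloch")
  case True
  then have "bloch_weight (\<lambda>z. f z - h z) z = bloch_weight (\<lambda>z. h z - f z) z" if "z \<in> \<D>" for z
    using that by (simp add: bloch_weight_def deriv_diff_bloch norm_minus_commute)
  then have "bloch_seminorm (\<lambda>z. f z - h z) = bloch_seminorm (\<lambda>z. h z - f z)"
    unfolding bloch_seminorm_def by (intro SUP_cong) auto
  then show ?thesis
    by (simp add: bloch_dist_def bloch_norm_def norm_minus_commute)
qed (auto simp: bloch_dist_def)

lemma bloch_norm_nonneg: "f \<in> bloch \<Longrightarrow> 0 \<le> bloch_norm f"
  by (simp add: bloch_norm_def bloch_seminorm_nonneg)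

lemma bloch_norm_zero: "bloch_norm (\<lambda>z. 0) = 0"
  by (simp add: bloch_norm_def bloch_seminorm_def bloch_weight_def)

lemma bloch_dist_triangle:
  assumes "f \<in> bloch" "h \<in> bloch" "k \<in> bloch"
  shows "bloch_dist f k \<le> bloch_dist f h + bloch_dist h k"
proof -
  let ?u = "\<lambda>z. f z - h z" and ?v = "\<lambda>z. k z - h z"
  have uv: "?u \<in> bloch" "?v \<in> bloch"
    using assms by (auto intro: bloch_diff)
  have "bloch_weight (\<lambda>z. f z - k z) z \<le> bloch_seminorm ?u + bloch_seminorm ?v" if "z \<in> \<D>" for z
    using bloch_weight_diff_le[OF uv that] bloch_weight_le_seminorm[OF uv(1) that]
      bloch_weight_le_seminorm[OF uv(2) that] by simp
  then have "bloch_seminorm (\<lambda>z. f z - k z) \<le> bloch_seminorm ?u + bloch_seminorm ?v"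
    unfolding bloch_seminorm_def[of "\<lambda>z. f z - k z"] by (intro cSUP_least) auto
  moreover have "cmod (f 0 - k 0) \<le> cmod (f 0 - h 0) + cmod (k 0 - h 0)"
    using norm_triangle_ineq4[of "f 0 - h 0" "k 0 - h 0"] by simp
  ultimately have "bloch_dist f k \<le> bloch_dist f h + bloch_dist k h"
    using assms by (simp add: bloch_dist_def bloch_norm_def)
  then show ?thesis by (simp add: bloch_dist_commute)
qed

lemma Metric_space_bloch: "Metric_space bloch bloch_dist"
proof
  show "0 \<le> bloch_dist f h" for f h
    by (simp add: bloch_dist_def bloch_norm_nonneg bloch_diff)
  show "bloch_dist f h = bloch_dist h f" for f h
    by (rule bloch_dist_commute)
  show "bloch_dist f h = 0 \<longleftrightarrow> f = h" if "f \<in> bloch" "h \<in> bloch" for f h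
    using that bloch_norm_eq_0_D[OF bloch_diff[OF that]]
    by (auto simp: bloch_dist_def bloch_norm_zero)
qed (rule bloch_dist_triangle)

definition bloch_topology :: "(complex \<Rightarrow> complex) topology"
  where "bloch_topology = Metric_space.mtopology bloch bloch_dist"

definition bloch_linear :: "((complex \<Rightarrow> complex) \<Rightarrow> complex \<Rightarrow> complex) \<Rightarrow> bool"
  where "bloch_linear T \<longleftrightarrow> T ` bloch \<subseteq> bloch \<and>
    (\<forall>f\<in>bloch. \<forall>h\<in>bloch. \<forall>a b. T (\<lambda>z. a * f z + b * h z) = (\<lambda>z. a * T f z + b * T h z))"

definition bloch_compact_operator :: "((complex \<Rightarrow> complex) \<Rightarrow> complex \<Rightarrow> complex) \<Rightarrow> bool"
  where "bloch_compact_operator T \<longleftrightarrow> bloch_linear T \<and>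
    compactin bloch_topology (bloch_topology closure_of (T ` {f \<in> bloch. bloch_norm f \<le> 1}))"

definition composition_op :: "(complex \<Rightarrow> complex) \<Rightarrow> (complex \<Rightarrow> complex) \<Rightarrow> complex \<Rightarrow> complex"
  where "composition_op \<phi> f = (\<lambda>z. if z \<in> \<D> then f (\<phi> z) else 0)"

definition integral_op :: "(complex \<Rightarrow> complex) \<Rightarrow> (complex \<Rightarrow> complex) \<Rightarrow> complex \<Rightarrow> complex"
  where "integral_op g f =
    (\<lambda>z. if z \<in> \<D> then contour_integral (linepath 0 z) (\<lambda>\<zeta>. deriv f \<zeta> * g \<zeta>) else 0)"

definition essentially_commutative_on_bloch ::
  "((complex \<Rightarrow> complex) \<Rightarrow> complex \<Rightarrow> complex) \<Rightarrow>
   ((complex \<Rightarrow> complex) \<Rightarrow> complex \<Rightarrow> complex) \<Rightarrow> bool"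
  where "essentially_commutative_on_bloch S T \<longleftrightarrow>
    bloch_compact_operator (\<lambda>f z. S (T f) z - T (S f) z)"

definition hyperbolic_deriv :: "(complex \<Rightarrow> complex) \<Rightarrow> complex \<Rightarrow> complex"
  where "hyperbolic_deriv \<phi> z =
    complex_of_real ((1 - (cmod z)\<^sup>2) / (1 - (cmod (\<phi> z))\<^sup>2)) * deriv \<phi> z"

text \<open>The limit of \<open>F z\<close> is \<open>0\<close> as \<open>\<bar>\<phi> z\<bar>\<close> tends to \<open>1\<close>; true if \<open>\<bar>\<phi>\<bar>\<close> is bounded away
  from \<open>1\<close> on the disk.\<close>

definition vanishes_as_modulus_to_1 :: "(complex \<Rightarrow> complex) \<Rightarrow> (complex \<Rightarrow> real) \<Rightarrow> bool"
  where "vanishes_as_modulus_to_1 \<phi> F \<longleftrightarrow>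
    (\<forall>\<epsilon>>0. \<exists>r\<in>{0<..<1}. \<forall>z\<in>\<D>. cmod (\<phi> z) > r \<longrightarrow> \<bar>F z\<bar> < \<epsilon>)"

end

theory Submission
  imports Defs
begin

text \<open>
  Write \<open>T\<close> for the commutator of \<open>C\<^sub>\<phi>\<close> and \<open>I\<^sub>g\<close>, and let
  \<open>\<kappa>(z) = \<bar>\<phi>\<^sup>#(z)\<bar> \<bar>g(\<phi>(z)) - g(z)\<bar>\<close>. Differentiating removes the integrals, and the chain rule gives
  \<open>(T f)'(z) = f'(\<phi>(z)) \<phi>'(z) (g(\<phi>(z)) - g(z))\<close>. Multiplying by \<open>1 - \<bar>z\<bar>\<^sup>2\<close>, the whole problem is
  contained in one identity (\<open>bloch_weight_commutator\<close>): the Bloch weight of \<open>T f\<close> at \<open>z\<close> is \<open>\<kappa>(z)\<close>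
  times the Bloch weight of \<open>f\<close> at \<open>\<phi>(z)\<close>. By the Schwarz--Pick inequality and the boundedness
  of \<open>g\<close>, the factor \<open>\<kappa>\<close> is bounded, so that \<open>T\<close> acts on the Bloch space.

  Suppose \<open>\<kappa>\<close> vanishes as \<open>\<bar>\<phi>\<bar>\<close> tends to \<open>1\<close>. Given a sequence in the unit ball, Montel's theorem
  applied to the derivatives, followed by taking a primitive, produces a subsequence \<open>f\<^sub>n\<close> and an
  element \<open>h\<close> of the unit ball such that \<open>f\<^sub>n'\<close> tends to \<open>h'\<close> uniformly on compact sets
  (\<open>bloch_unit_ball_derivs_compact\<close>). Then \<open>T f\<^sub>n\<close> tends to \<open>T h\<close> in norm: where \<open>\<bar>\<phi>(z)\<bar>\<close> is close to
  \<open>1\<close> the factor \<open>\<kappa>(z)\<close> is small, and elsewhere \<open>\<phi>(z)\<close> stays in a compact set, on which the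
  derivatives converge uniformly (\<open>bloch_norm_commutator_le\<close>). So the image of the unit ball is itself
  compact.

  Suppose conversely that \<open>\<kappa>(z\<^sub>n) \<ge> \<epsilon> > 0\<close> while \<open>\<bar>\<phi>(z\<^sub>n)\<bar>\<close> tends to \<open>1\<close>. Disk automorphisms
  shifted to vanish at \<open>0\<close> give functions \<open>p\<^sub>n\<close> in the unit ball whose Bloch weight is \<open>1\<close> at
  \<open>\<phi>(z\<^sub>n)\<close> and tends to \<open>0\<close> at every fixed point. Compactness yields a Bloch limit \<open>F\<close> of a
  subsequence of \<open>T p\<^sub>n\<close>. Pointwise decay forces \<open>F' = 0\<close>, whereas the weight of
  \<open>T p\<^sub>n - F\<close> at \<open>z\<^sub>n\<close> is \<open>\<kappa>(z\<^sub>n) \<ge> \<epsilon>\<close>, which contradicts convergence.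
\<close>

section \<open>Disk automorphisms and the Schwarz--Pick inequality\<close>

lemma has_field_derivative_deriv_disk:
  "f holomorphic_on \<D> \<Longrightarrow> z \<in> \<D> \<Longrightarrow> (f has_field_derivative deriv f z) (at z)"
  by (rule holomorphic_derivI[OF _ open_ball])

lemma holomorphic_on_diskI:
  assumes "\<And>z. z \<in> \<D> \<Longrightarrow> (f has_field_derivative f' z) (at z)"
  shows "f holomorphic_on \<D>"
  unfolding holomorphic_on_open[OF open_ball] using assms by blast

lemma one_minus_cnj_mult_nonzero:
  assumes "w \<in> \<D>" "z \<in> \<D>"
  shows "1 - cnj w * z \<noteq> 0"
proof
  assume "1 - cnj w * z = 0"
  then have "cmod w * cmod z = 1"
    by (metis complex_mod_cnj norm_mult norm_one right_minus_eq)
  moreover have "cmod w * cmod z < 1"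
    using assms norm_mult_less[of w 1 z 1] by (simp add: norm_mult)
  ultimately show False
    by simp
qed

lemma has_field_derivative_Moebius_function:
  assumes "w \<in> \<D>" "z \<in> \<D>"
  shows "(Moebius_function 0 w has_field_derivative
           complex_of_real (1 - (cmod w)\<^sup>2) / (1 - cnj w * z)\<^sup>2) (at z)"
proof -
  have "((\<lambda>z. (z - w) / (1 - cnj w * z)) has_field_derivative
          (1 * (1 - cnj w * z) - (z - w) * (- cnj w)) / ((1 - cnj w * z) * (1 - cnj w * z))) (at z)"
    using one_minus_cnj_mult_nonzero[OF assms]
    by (auto intro!: derivative_eq_intros)
  moreover have "1 * (1 - cnj w * z) - (z - w) * (- cnj w) = complex_of_real (1 - (cmod w)\<^sup>2)"
    by (simp only: of_real_diff complex_norm_square of_real_1) (simp add: algebra_simps)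
  moreover have "Moebius_function 0 w = (\<lambda>z. (z - w) / (1 - cnj w * z))"
    by (simp add: fun_eq_iff Moebius_function_simple)
  ultimately show ?thesis
    by (simp only: power2_eq_square)
qed

lemma disk_selfmap_norm_less_1: "\<phi> \<in> disk_selfmaps \<Longrightarrow> cmod z < 1 \<Longrightarrow> cmod (\<phi> z) < 1"
  unfolding disk_selfmaps_def by force

text \<open>Conjugating \<open>\<phi>\<close> by the automorphisms that move \<open>a\<close> and \<open>\<phi> a\<close> to \<open>0\<close> gives a self-map fixing \<open>0\<close>,
  to which the Schwarz lemma applies. The derivatives \<open>1 - \<bar>a\<bar>\<^sup>2\<close> and \<open>1 / (1 - \<bar>\<phi> a\<bar>\<^sup>2)\<close> of the two
  automorphisms turn its derivative at \<open>0\<close> into exactly the hyperbolic derivative at \<open>a\<close>.\<close>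

lemma Schwarz_Pick_hyperbolic_deriv:
  assumes "\<phi> \<in> disk_selfmaps" and a: "a \<in> \<D>"
  shows "cmod (hyperbolic_deriv \<phi> a) \<le> 1"
proof -
  have hol: "\<phi> holomorphic_on \<D>" and maps: "\<And>z. z \<in> \<D> \<Longrightarrow> \<phi> z \<in> \<D>"
    using assms(1) disk_selfmap_norm_less_1[OF assms(1)] by (auto simp: disk_selfmaps_def)
  define \<psi> where "\<psi> = Moebius_function 0 (\<phi> a) \<circ> (\<phi> \<circ> Moebius_function 0 (- a))"
  have M0: "Moebius_function 0 (- a) 0 = a"
    by (simp add: Moebius_function_simple)
  have Mball: "Moebius_function 0 w z \<in> \<D>" if "w \<in> \<D>" "z \<in> \<D>" for w z
    using Moebius_function_norm_lt_1 that by simp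
  have a': "- a \<in> \<D>"
    using a by simp
  have hol\<psi>: "\<psi> holomorphic_on \<D>"
    unfolding \<psi>_def
    by (intro holomorphic_on_compose_gen[where t = \<D>] Moebius_function_holomorphic hol)
      (use a in \<open>auto intro!: Moebius_function_norm_lt_1 disk_selfmap_norm_less_1[OF assms(1)]\<close>)
  have "cmod (deriv \<psi> 0) \<le> 1"
  proof (rule Schwarz_Lemma(2)[OF hol\<psi>, of 0])
    show "\<psi> 0 = 0"
      by (simp add: \<psi>_def M0 Moebius_function_eq_zero)
    show "cmod (\<psi> z) < 1" if "cmod z < 1" for z
      using Mball[OF maps[OF a] maps[OF Mball[OF a', of z]]] that by (simp add: \<psi>_def)
  qed simp
  moreover have "deriv \<psi> 0 = hyperbolic_deriv \<phi> a"
  proof -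
    let ?p = "complex_of_real (1 - (cmod (\<phi> a))\<^sup>2)" and ?q = "complex_of_real (1 - (cmod a)\<^sup>2)"
    have p: "?p \<noteq> 0"
      using one_minus_norm_sq_pos[OF maps[OF a]] by (simp del: of_real_diff)
    have "(Moebius_function 0 (- a) has_field_derivative ?q) (at 0)"
      using has_field_derivative_Moebius_function[OF a', of 0] by simp
    moreover have "(\<phi> has_field_derivative deriv \<phi> a) (at a)"
      by (rule has_field_derivative_deriv_disk[OF hol a])
    moreover have "1 - cnj (\<phi> a) * \<phi> a = ?p"
      by (simp only: of_real_diff complex_norm_square of_real_1) (simp add: algebra_simps)
    with has_field_derivative_Moebius_function[OF maps[OF a] maps[OF a]]
    have "(Moebius_function 0 (\<phi> a) has_field_derivative 1 / ?p) (at (\<phi> a))"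
      using p by (simp add: power2_eq_square)
    ultimately have "(\<psi> has_field_derivative 1 / ?p * (deriv \<phi> a * ?q)) (at 0)"
      unfolding \<psi>_def by (intro DERIV_chain) (simp_all add: M0)
    then show ?thesis
      by (simp add: DERIV_imp_deriv hyperbolic_deriv_def)
  qed
  ultimately show ?thesis
    by simp
qed

section \<open>The operators and their commutator\<close>

lemma bloch_holomorphic: "f \<in> bloch \<Longrightarrow> f holomorphic_on \<D>"
  by (simp add: bloch_def)

lemma bloch_memI:
  assumes "f holomorphic_on \<D>" "\<And>z. z \<notin> \<D> \<Longrightarrow> f z = 0"
    and "\<And>z. z \<in> \<D> \<Longrightarrow> bloch_weight f z \<le> C"
  shows "f \<in> bloch"
  using assms unfolding bloch_def by (auto intro!: bdd_aboveI2[of _ _ C])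

lemma bloch_seminorm_le:
  assumes "\<And>z. z \<in> \<D> \<Longrightarrow> bloch_weight f z \<le> C"
  shows "bloch_seminorm f \<le> C"
  unfolding bloch_seminorm_def using assms by (intro cSUP_least) auto

lemma disk_primitive_exists:
  assumes "k holomorphic_on \<D>"
  obtains F where "\<And>z. z \<in> \<D> \<Longrightarrow> (F has_field_derivative k z) (at z)"
proof -
  obtain F where "\<And>z. z \<in> \<D> \<Longrightarrow> (F has_field_derivative k z) (at z within \<D>)"
    using holomorphic_convex_primitive'[OF convex_ball open_ball assms] by blast
  then show thesis
    using that by (metis at_within_open open_ball)
qed

lemma segment_from_0_subset_cball: "closed_segment 0 z \<subseteq> cball 0 (cmod z)"
  by (intro closed_segment_subset convex_cball) auto

text \<open>All properties of \<open>I\<^sub>g\<close> used below come from primitives: this replaces the contour integral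
  by a difference of values of any convenient primitive.\<close>

lemma integral_op_eq_primitive:
  assumes F: "\<And>z. z \<in> \<D> \<Longrightarrow> (F has_field_derivative deriv f z * g z) (at z)"
    and z: "z \<in> \<D>"
  shows "integral_op g f z = F z - F 0"
proof -
  have "((\<lambda>\<zeta>. deriv f \<zeta> * g \<zeta>) has_contour_integral
          F (pathfinish (linepath 0 z)) - F (pathstart (linepath 0 z))) (linepath 0 z)"
  proof (rule contour_integral_primitive[where S = \<D>])
    show "path_image (linepath 0 z) \<subseteq> \<D>"
      using segment_from_0_subset_cball[of z] z by auto
    show "(F has_field_derivative deriv f u * g u) (at u within \<D>)" if "u \<in> \<D>" for u
      by (rule has_field_derivative_at_within[OF F[OF that]])
  qed (rule valid_path_linepath)
  then show ?thesis
    using z by (simp add: integral_op_def contour_integral_unique)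
qed

lemma integral_op_0: "integral_op g f 0 = 0"
  by (simp add: integral_op_def)

lemma deriv_times_holomorphic:
  "f holomorphic_on \<D> \<Longrightarrow> g holomorphic_on \<D> \<Longrightarrow> (\<lambda>z. deriv f z * g z) holomorphic_on \<D>"
  by (intro holomorphic_intros) auto

lemma has_field_derivative_integral_op:
  assumes "f holomorphic_on \<D>" "g holomorphic_on \<D>" "z \<in> \<D>"
  shows "(integral_op g f has_field_derivative deriv f z * g z) (at z)"
proof -
  obtain F where F: "\<And>z. z \<in> \<D> \<Longrightarrow> (F has_field_derivative deriv f z * g z) (at z)"
    using disk_primitive_exists[OF deriv_times_holomorphic[OF assms(1,2)]] by blast
  have "((\<lambda>z. F z - F 0) has_field_derivative deriv f z * g z) (at z)"
    using DERIV_diff[OF F[OF assms(3)] DERIV_const[of "F 0"]] by simp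
  then show ?thesis
    by (rule has_field_derivative_transform_within_open[where S = \<D>])
      (use assms(3) integral_op_eq_primitive[OF F] in auto)
qed

text \<open>The same combination of \<open>I\<^sub>g f\<close> and \<open>I\<^sub>g h\<close> is a primitive of the integrand on the left, and it
  vanishes at \<open>0\<close>.\<close>

lemma integral_op_lincomb:
  assumes "f holomorphic_on \<D>" "h holomorphic_on \<D>" "g holomorphic_on \<D>"
  shows "integral_op g (\<lambda>z. a * f z + b * h z) =
    (\<lambda>z. a * integral_op g f z + b * integral_op g h z)"
proof
  fix z
  show "integral_op g (\<lambda>z. a * f z + b * h z) z = a * integral_op g f z + b * integral_op g h z"
  proof (cases "z \<in> \<D>")
    case True
    have "((\<lambda>z. a * integral_op g f z + b * integral_op g h z) has_field_derivative
            deriv (\<lambda>z. a * f z + b * h z) u * g u) (at u)" if u: "u \<in> \<D>" for u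
    proof -
      have "((\<lambda>z. a * f z + b * h z) has_field_derivative a * deriv f u + b * deriv h u) (at u)"
        by (intro DERIV_add DERIV_cmult has_field_derivative_deriv_disk assms u)
      moreover have "((\<lambda>z. a * integral_op g f z + b * integral_op g h z) has_field_derivative
              a * (deriv f u * g u) + b * (deriv h u * g u)) (at u)"
        by (intro DERIV_add DERIV_cmult has_field_derivative_integral_op assms u)
      ultimately show ?thesis
        by (simp add: DERIV_imp_deriv algebra_simps)
    qed
    from integral_op_eq_primitive[OF this True] show ?thesis
      by (simp add: integral_op_0)
  qed (simp add: integral_op_def)
qed

text \<open>The length of the segment from \<open>0\<close> to \<open>z\<close> is below \<open>1\<close>, so it does not enter the bound.\<close>

lemma integral_op_bound:
  assumes "f holomorphic_on \<D>" "g holomorphic_on \<D>" "z \<in> \<D>" "0 \<le> C"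
    and "\<And>u. cmod u \<le> cmod z \<Longrightarrow> cmod (deriv f u * g u) \<le> C"
  shows "cmod (integral_op g f z) \<le> C"
proof -
  have "cmod (integral_op g f z - integral_op g f 0) \<le> C * cmod (z - 0)"
  proof (rule field_differentiable_bound[where S = "cball 0 (cmod z)"])
    show "(integral_op g f has_field_derivative deriv f u * g u) (at u within cball 0 (cmod z))"
      if "u \<in> cball 0 (cmod z)" for u
      using that assms(3)
      by (intro has_field_derivative_at_within[OF has_field_derivative_integral_op[OF assms(1,2)]]) auto
  qed (use assms(5) in auto)
  also have "\<dots> \<le> C"
    using assms(3,4) by (simp add: mult_left_le)
  finally show ?thesis
    by (simp add: integral_op_0)
qed

lemma has_field_derivative_composition_op:
  assumes "\<phi> \<in> disk_selfmaps" "z \<in> \<D>" "(f has_field_derivative d) (at (\<phi> z))"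
  shows "(composition_op \<phi> f has_field_derivative d * deriv \<phi> z) (at z)"
proof -
  have "(\<phi> has_field_derivative deriv \<phi> z) (at z)"
    using assms by (intro has_field_derivative_deriv_disk) (auto simp: disk_selfmaps_def)
  with assms(3) have "(f \<circ> \<phi> has_field_derivative d * deriv \<phi> z) (at z)"
    by (rule DERIV_chain)
  then show ?thesis
    by (rule has_field_derivative_transform_within_open[where S = \<D>])
      (use assms(2) in \<open>auto simp: composition_op_def\<close>)
qed

lemma composition_op_holomorphic:
  assumes "\<phi> \<in> disk_selfmaps" "f holomorphic_on \<D>"
  shows "composition_op \<phi> f holomorphic_on \<D>"
proof -
  have "(composition_op \<phi> f has_field_derivative deriv f (\<phi> z) * deriv \<phi> z) (at z)"
    if "z \<in> \<D>" for z
    using that assms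
    by (intro has_field_derivative_composition_op has_field_derivative_deriv_disk)
      (auto simp: disk_selfmap_norm_less_1)
  then show ?thesis
    by (rule holomorphic_on_diskI)
qed

locale disk_symbols =
  fixes \<phi> g :: "complex \<Rightarrow> complex"
  assumes selfmap: "\<phi> \<in> disk_selfmaps" and bounded_symbol: "g \<in> H_infinity"
begin

definition commutator :: "(complex \<Rightarrow> complex) \<Rightarrow> complex \<Rightarrow> complex"
  where "commutator f z =
    composition_op \<phi> (integral_op g f) z - integral_op g (composition_op \<phi> f) z"

text \<open>The function \<open>\<kappa>\<close> by which the commutator distorts Bloch weights, see
  \<open>bloch_weight_commutator\<close> below.\<close>

definition symbol :: "complex \<Rightarrow> real"
  where "symbol z = cmod (hyperbolic_deriv \<phi> z) * cmod (g (\<phi> z) - g z)"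

lemma selfmap_in: "z \<in> \<D> \<Longrightarrow> \<phi> z \<in> \<D>"
  using disk_selfmap_norm_less_1[OF selfmap] by simp

lemma g_holomorphic: "g holomorphic_on \<D>"
  using bounded_symbol by (simp add: H_infinity_def)

lemma g_bound: obtains M where "0 < M" "\<And>z. z \<in> \<D> \<Longrightarrow> cmod (g z) \<le> M"
  using bounded_symbol unfolding H_infinity_def bounded_pos by auto

lemma symbol_nonneg: "0 \<le> symbol z"
  by (simp add: symbol_def)

lemma symbol_le:
  assumes "\<And>z. z \<in> \<D> \<Longrightarrow> cmod (g z) \<le> M" and "z \<in> \<D>"
  shows "symbol z \<le> 2 * M"
proof -
  have "cmod (g (\<phi> z) - g z) \<le> cmod (g (\<phi> z)) + cmod (g z)"
    by (rule norm_triangle_ineq4)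
  also have "\<dots> \<le> 2 * M"
    using assms(1)[OF assms(2)] assms(1)[OF selfmap_in[OF assms(2)]] by simp
  finally show ?thesis
    unfolding symbol_def using Schwarz_Pick_hyperbolic_deriv[OF selfmap assms(2)]
    by (smt (verit) mult_left_le_one_le norm_ge_zero)
qed

lemma has_field_derivative_commutator:
  assumes "f holomorphic_on \<D>" "z \<in> \<D>"
  shows "(commutator f has_field_derivative
           deriv f (\<phi> z) * deriv \<phi> z * (g (\<phi> z) - g z)) (at z)"
proof -
  have 1: "(composition_op \<phi> (integral_op g f) has_field_derivative
      deriv f (\<phi> z) * g (\<phi> z) * deriv \<phi> z) (at z)"
    by (intro has_field_derivative_composition_op selfmap assms
        has_field_derivative_integral_op g_holomorphic selfmap_in)
  have "(composition_op \<phi> f has_field_derivative deriv f (\<phi> z) * deriv \<phi> z) (at z)"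
    by (intro has_field_derivative_composition_op has_field_derivative_deriv_disk
        selfmap selfmap_in assms)
  then have 2: "(integral_op g (composition_op \<phi> f) has_field_derivative
      deriv f (\<phi> z) * deriv \<phi> z * g z) (at z)"
    using has_field_derivative_integral_op[OF composition_op_holomorphic[OF selfmap assms(1)]
        g_holomorphic assms(2)] by (simp add: DERIV_imp_deriv)
  have "commutator f =
      (\<lambda>z. composition_op \<phi> (integral_op g f) z - integral_op g (composition_op \<phi> f) z)"
    by (simp add: fun_eq_iff commutator_def)
  with DERIV_diff[OF 1 2] show ?thesis
    by (simp add: algebra_simps)
qed

text \<open>The factor \<open>1 - \<bar>\<phi> z\<bar>\<^sup>2\<close> of the weight at \<open>\<phi> z\<close> cancels the denominator of the hyperbolic
  derivative. This identity reduces both directions of the theorem to estimates on \<open>symbol\<close>.\<close>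

lemma bloch_weight_commutator:
  assumes "f holomorphic_on \<D>" "z \<in> \<D>"
  shows "bloch_weight (commutator f) z = symbol z * bloch_weight f (\<phi> z)"
proof -
  have "0 < 1 - (cmod z)\<^sup>2" "0 < 1 - (cmod (\<phi> z))\<^sup>2"
    using one_minus_norm_sq_pos assms(2) selfmap_in by auto
  then show ?thesis
    by (simp add: bloch_weight_def symbol_def hyperbolic_deriv_def norm_mult norm_divide
        DERIV_imp_deriv[OF has_field_derivative_commutator[OF assms]] del: of_real_diff of_real_divide)
qed

lemma commutator_in_bloch:
  assumes "f \<in> bloch"
  shows "commutator f \<in> bloch"
proof -
  obtain M where M: "0 < M" "\<And>z. z \<in> \<D> \<Longrightarrow> cmod (g z) \<le> M"
    using g_bound by blast
  note hol = bloch_holomorphic[OF assms]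
  show ?thesis
  proof (rule bloch_memI)
    show "commutator f holomorphic_on \<D>"
      by (rule holomorphic_on_diskI[OF has_field_derivative_commutator[OF hol]])
    show "commutator f z = 0" if "z \<notin> \<D>" for z
      using that by (simp add: commutator_def composition_op_def integral_op_def)
    show "bloch_weight (commutator f) z \<le> 2 * M * bloch_seminorm f" if z: "z \<in> \<D>" for z
      unfolding bloch_weight_commutator[OF hol z]
      using M(1) symbol_le[OF M(2) z] bloch_weight_le_seminorm[OF assms selfmap_in[OF z]]
      by (intro mult_mono) (auto simp: bloch_weight_nonneg[OF selfmap_in[OF z]])
  qed
qed

lemma commutator_lincomb:
  assumes "f \<in> bloch" "h \<in> bloch"
  shows "commutator (\<lambda>z. a * f z + b * h z) = (\<lambda>z. a * commutator f z + b * commutator h z)"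
proof -
  have hol: "f holomorphic_on \<D>" "h holomorphic_on \<D>"
    using assms by (auto intro: bloch_holomorphic)
  have "composition_op \<phi> (\<lambda>z. a * f z + b * h z) =
      (\<lambda>z. a * composition_op \<phi> f z + b * composition_op \<phi> h z)"
    by (simp add: fun_eq_iff composition_op_def)
  then show ?thesis
    using integral_op_lincomb[OF hol g_holomorphic]
      integral_op_lincomb[OF composition_op_holomorphic[OF selfmap hol(1)]
        composition_op_holomorphic[OF selfmap hol(2)] g_holomorphic]
    by (simp add: fun_eq_iff commutator_def composition_op_def algebra_simps)
qed

lemma commutator_diff:
  assumes "f \<in> bloch" "h \<in> bloch"
  shows "commutator (\<lambda>z. f z - h z) = (\<lambda>z. commutator f z - commutator h z)"
  using commutator_lincomb[OF assms, of 1 "-1"] by simp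

lemma bloch_linear_commutator: "bloch_linear commutator"
  unfolding bloch_linear_def using commutator_in_bloch commutator_lincomb by blast

section \<open>The vanishing condition makes the commutator compact\<close>

text \<open>The disk is split according to whether \<open>\<bar>\<phi> z\<bar> \<le> r\<close>. On that part the weight of \<open>h\<close> at
  \<open>\<phi> z\<close> is at most \<open>\<eta>\<close> and the symbol at most \<open>2 M\<close>; on the other part the symbol is at most \<open>\<epsilon>\<close> and the
  weight at most \<open>B\<close>. The third \<open>M * \<eta>\<close> pays for the value at \<open>0\<close>, which is an integral over a
  segment inside the disk of radius \<open>r\<close>.\<close>

lemma bloch_norm_commutator_le:
  assumes h: "h \<in> bloch" "bloch_seminorm h \<le> B"
    and M: "0 < M" "\<And>z. z \<in> \<D> \<Longrightarrow> cmod (g z) \<le> M"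
    and r: "cmod (\<phi> 0) \<le> r" "r < 1"
    and \<eta>: "0 \<le> \<eta>" "\<And>u. cmod u \<le> r \<Longrightarrow> cmod (deriv h u) \<le> \<eta>"
    and \<epsilon>: "0 \<le> \<epsilon>" "\<And>z. z \<in> \<D> \<Longrightarrow> r < cmod (\<phi> z) \<Longrightarrow> symbol z \<le> \<epsilon>"
  shows "bloch_norm (commutator h) \<le> 3 * M * \<eta> + \<epsilon> * B"
proof -
  note hol = bloch_holomorphic[OF h(1)]
  have B: "0 \<le> B"
    using bloch_seminorm_nonneg[OF h(1)] h(2) by simp
  have "cmod (integral_op g h (\<phi> 0)) \<le> \<eta> * M"
  proof (rule integral_op_bound[OF hol g_holomorphic])
    show "cmod (deriv h u * g u) \<le> \<eta> * M" if "cmod u \<le> cmod (\<phi> 0)" for u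
      unfolding norm_mult using that r \<eta> M by (intro mult_mono) auto
  qed (use selfmap_in[of 0] \<eta> M in auto)
  then have at0: "cmod (commutator h 0) \<le> M * \<eta>"
    by (simp add: commutator_def composition_op_def integral_op_0 mult.commute)
  have "bloch_seminorm (commutator h) \<le> 2 * M * \<eta> + \<epsilon> * B"
  proof (rule bloch_seminorm_le)
    fix z assume z: "z \<in> \<D>"
    note \<phi>z = selfmap_in[OF z]
    show "bloch_weight (commutator h) z \<le> 2 * M * \<eta> + \<epsilon> * B"
    proof (cases "cmod (\<phi> z) \<le> r")
      case True
      have "bloch_weight h (\<phi> z) \<le> 1 * \<eta>"
        unfolding bloch_weight_def using one_minus_norm_sq_pos[OF \<phi>z] \<eta> True
        by (intro mult_mono) auto
      then have "symbol z * bloch_weight h (\<phi> z) \<le> 2 * M * \<eta>"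
        using symbol_le[OF M(2) z] M(1) bloch_weight_nonneg[OF \<phi>z]
        by (intro mult_mono) auto
      moreover have "0 \<le> \<epsilon> * B"
        using \<epsilon> B by simp
      ultimately show ?thesis
        by (simp add: bloch_weight_commutator[OF hol z])
    next
      case False
      have "symbol z * bloch_weight h (\<phi> z) \<le> \<epsilon> * B"
        using False \<epsilon> z bloch_weight_le_seminorm[OF h(1) \<phi>z] h(2) bloch_weight_nonneg[OF \<phi>z]
        by (intro mult_mono) auto
      moreover have "0 \<le> 2 * M * \<eta>"
        using M \<eta> by simp
      ultimately show ?thesis
        by (simp add: bloch_weight_commutator[OF hol z])
    qed
  qed
  with at0 show ?thesis
    by (simp add: bloch_norm_def)
qed

lemma commutator_norm_tendsto_0:
  assumes van: "vanishes_as_modulus_to_1 \<phi> symbol"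
    and h: "\<And>n. h n \<in> bloch" "\<And>n. bloch_seminorm (h n) \<le> B"
    and lim: "\<And>K. compact K \<Longrightarrow> K \<subseteq> \<D> \<Longrightarrow> uniform_limit K (\<lambda>n. deriv (h n)) (\<lambda>_. 0) sequentially"
  shows "(\<lambda>n. bloch_norm (commutator (h n))) \<longlonglongrightarrow> 0"
proof (rule LIMSEQ_I)
  fix e :: real assume e: "0 < e"
  obtain M where M: "0 < M" "\<And>z. z \<in> \<D> \<Longrightarrow> cmod (g z) \<le> M"
    using g_bound by blast
  have B: "0 \<le> B"
    using bloch_seminorm_nonneg[OF h(1)] h(2) by (rule order_trans)
  \<comment> \<open>With these choices \<open>3 * M * \<eta> = e / 2\<close> and \<open>\<epsilon> * B < e / 2\<close>; the \<open>+ 1\<close> covers \<open>B = 0\<close>.\<close>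
  define \<epsilon> where "\<epsilon> = e / (2 * (B + 1))"
  define \<eta> where "\<eta> = e / (6 * M)"
  have pos: "0 < \<epsilon>" "0 < \<eta>"
    using e B M by (auto simp: \<epsilon>_def \<eta>_def)
  obtain r where r: "0 < r" "r < 1" "\<And>z. z \<in> \<D> \<Longrightarrow> r < cmod (\<phi> z) \<Longrightarrow> symbol z < \<epsilon>"
    using van pos(1) unfolding vanishes_as_modulus_to_1_def abs_of_nonneg[OF symbol_nonneg]
    by (meson greaterThanLessThan_iff)
  \<comment> \<open>Enlarging the radius so that \<open>\<phi> 0\<close> is covered lets one bound control the value at \<open>0\<close> too.\<close>
  define s where "s = max r (cmod (\<phi> 0))"
  have s: "cmod (\<phi> 0) \<le> s" "s < 1" "r \<le> s"
    using r selfmap_in[of 0] by (auto simp: s_def)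
  have "uniform_limit (cball 0 s) (\<lambda>n. deriv (h n)) (\<lambda>_. 0) sequentially"
    using s(2) by (intro lim) auto
  then obtain N where N: "\<And>n u. N \<le> n \<Longrightarrow> cmod u \<le> s \<Longrightarrow> cmod (deriv (h n) u) < \<eta>"
    using pos(2) unfolding uniform_limit_sequentially_iff dist_norm diff_0_right
    by (metis mem_cball_0)
  have "norm (bloch_norm (commutator (h n)) - 0) < e" if n: "N \<le> n" for n
  proof -
    have "bloch_norm (commutator (h n)) \<le> 3 * M * \<eta> + \<epsilon> * B"
    proof (rule bloch_norm_commutator_le[OF h(1) h(2) M s(1,2)])
      show "cmod (deriv (h n) u) \<le> \<eta>" if "cmod u \<le> s" for u
        using N[OF n that] by simp
      show "symbol z \<le> \<epsilon>" if "z \<in> \<D>" "s < cmod (\<phi> z)" for z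
        using r(3)[OF that(1)] that(2) s(3) by simp
    qed (use pos in auto)
    also have "3 * M * \<eta> = e / 2"
      using M by (simp add: \<eta>_def)
    also have "\<epsilon> * B < e / 2"
      using e B by (simp add: \<epsilon>_def divide_simps)
    finally show ?thesis
      using bloch_norm_nonneg[OF commutator_in_bloch[OF h(1)[of n]]] by simp
  qed
  then show "\<exists>N. \<forall>n\<ge>N. norm (bloch_norm (commutator (h n)) - 0) < e"
    by blast
qed

end

lemma bloch_weight_le_norm:
  assumes "f \<in> bloch" "z \<in> \<D>"
  shows "bloch_weight f z \<le> bloch_norm f"
  using bloch_weight_le_seminorm[OF assms] by (simp add: bloch_norm_def add_increasing)

text \<open>The commutator only sees derivatives, so Montel's theorem is applied to the derivatives, which the
  Bloch norm bounds by \<open>1 / (1 - \<bar>z\<bar>\<^sup>2)\<close>. The limit function is recovered as the primitive that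
  vanishes at \<open>0\<close>; the values of the given functions at \<open>0\<close> need not converge.\<close>

lemma bloch_unit_ball_derivs_compact:
  assumes f: "\<And>n. f n \<in> bloch" "\<And>n. bloch_norm (f n) \<le> 1"
  obtains h r where "h \<in> bloch" "bloch_norm h \<le> 1" "strict_mono (r :: nat \<Rightarrow> nat)"
    "\<And>K. compact K \<Longrightarrow> K \<subseteq> \<D> \<Longrightarrow> uniform_limit K (\<lambda>n. deriv (f (r n))) (deriv h) sequentially"
proof -
  have bound: "\<exists>B. \<forall>k\<in>range (\<lambda>n. deriv (f n)). \<forall>z\<in>K. cmod (k z) \<le> B"
    if K: "compact K" "K \<subseteq> \<D>" for K
  proof -
    have "continuous_on K (\<lambda>z. 1 / (1 - (cmod z)\<^sup>2))"
      using K one_minus_norm_sq_pos by (intro continuous_intros) fastforce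
    then have "bounded ((\<lambda>z. 1 / (1 - (cmod z)\<^sup>2)) ` K)"
      using K compact_continuous_image compact_imp_bounded by blast
    then obtain B where B: "\<And>z. z \<in> K \<Longrightarrow> \<bar>1 / (1 - (cmod z)\<^sup>2)\<bar> \<le> B"
      unfolding bounded_iff by auto
    have "cmod (deriv (f n) z) \<le> B" if z: "z \<in> K" for n z
    proof -
      have zD: "z \<in> \<D>"
        using z K by blast
      have "(1 - (cmod z)\<^sup>2) * cmod (deriv (f n) z) \<le> 1"
        using bloch_weight_le_norm[OF f(1) zD] f(2) order_trans unfolding bloch_weight_def by blast
      then have "cmod (deriv (f n) z) \<le> 1 / (1 - (cmod z)\<^sup>2)"
        using one_minus_norm_sq_pos[OF zD] by (simp add: pos_le_divide_eq mult.commute)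
      then show ?thesis
        using B[OF z] by linarith
    qed
    then show ?thesis
      by blast
  qed
  obtain k r where k: "k holomorphic_on \<D>" and r: "strict_mono (r :: nat \<Rightarrow> nat)"
    and point: "\<And>z. z \<in> \<D> \<Longrightarrow> (\<lambda>n. deriv (f (r n)) z) \<longlonglongrightarrow> k z"
    and unif: "\<And>K. compact K \<Longrightarrow> K \<subseteq> \<D> \<Longrightarrow>
      uniform_limit K ((\<lambda>n. deriv (f n)) \<circ> r) k sequentially"
  proof (rule Montel[OF open_ball, of "range (\<lambda>n. deriv (f n))" 0 1 "\<lambda>n. deriv (f n)"])
    show "d holomorphic_on \<D>" if "d \<in> range (\<lambda>n. deriv (f n))" for d
      using that holomorphic_deriv[OF bloch_holomorphic[OF f(1)] open_ball] by auto
  qed (use bound in auto)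
  obtain F where F: "\<And>z. z \<in> \<D> \<Longrightarrow> (F has_field_derivative k z) (at z)"
    using disk_primitive_exists[OF k] by blast
  define h where "h z = (if z \<in> \<D> then F z - F 0 else 0)" for z
  have h': "(h has_field_derivative k z) (at z)" if "z \<in> \<D>" for z
  proof -
    have "((\<lambda>z. F z - F 0) has_field_derivative k z) (at z)"
      using DERIV_diff[OF F[OF that] DERIV_const[of "F 0"]] by simp
    then show ?thesis
      by (rule has_field_derivative_transform_within_open[where S = \<D>])
        (use that in \<open>auto simp: h_def\<close>)
  qed
  have dh: "deriv h z = k z" if "z \<in> \<D>" for z
    using h'[OF that] by (rule DERIV_imp_deriv)
  have weight: "bloch_weight h z \<le> 1" if z: "z \<in> \<D>" for z
  proof (rule LIMSEQ_le_const2)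
    show "(\<lambda>n. bloch_weight (f (r n)) z) \<longlonglongrightarrow> bloch_weight h z"
      unfolding bloch_weight_def dh[OF z] by (intro tendsto_intros point z)
    show "\<exists>N. \<forall>n\<ge>N. bloch_weight (f (r n)) z \<le> 1"
      using bloch_weight_le_norm[OF f(1) z] f(2) order_trans by blast
  qed
  have h: "h \<in> bloch"
  proof (rule bloch_memI)
    show "h holomorphic_on \<D>"
      by (rule holomorphic_on_diskI[OF h'])
  qed (use weight in \<open>auto simp: h_def\<close>)
  have "bloch_norm h \<le> 1"
    using bloch_seminorm_le[OF weight] by (simp add: bloch_norm_def h_def)
  moreover have "uniform_limit K (\<lambda>n. deriv (f (r n))) (deriv h) sequentially"
    if "compact K" "K \<subseteq> \<D>" for K
    using unif[OF that] dh that(2)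
    by (auto simp: uniform_limit_sequentially_iff o_def subset_iff)
  ultimately show thesis
    using that h r by blast
qed

interpretation bloch: Metric_space bloch bloch_dist
  rewrites "Metric_space.mtopology bloch bloch_dist = bloch_topology"
  by (rule Metric_space_bloch) (simp add: bloch_topology_def)

context disk_symbols
begin

text \<open>Sequential compactness: the limit provided by \<open>bloch_unit_ball_derivs_compact\<close> lies in the unit
  ball again, and linearity reduces convergence of the images to \<open>commutator_norm_tendsto_0\<close> for the
  differences. Hence the image is compact even before closing it.\<close>

lemma compactin_commutator_image:
  assumes "vanishes_as_modulus_to_1 \<phi> symbol"
  shows "compactin bloch_topology (commutator ` {f \<in> bloch. bloch_norm f \<le> 1})"
  unfolding bloch.compactin_sequentially
proof (intro conjI allI impI)
  let ?U = "{f \<in> bloch. bloch_norm f \<le> 1}"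
  show "commutator ` ?U \<subseteq> bloch"
    using commutator_in_bloch by auto
  fix \<sigma> :: "nat \<Rightarrow> complex \<Rightarrow> complex"
  assume "range \<sigma> \<subseteq> commutator ` ?U"
  then have "\<forall>n. \<exists>f. f \<in> ?U \<and> \<sigma> n = commutator f"
    by blast
  then obtain f where f: "\<And>n. f n \<in> ?U" and \<sigma>: "\<And>n. \<sigma> n = commutator (f n)"
    by metis
  obtain h r where h: "h \<in> bloch" "bloch_norm h \<le> 1" and r: "strict_mono (r :: nat \<Rightarrow> nat)"
    and unif: "\<And>K. compact K \<Longrightarrow> K \<subseteq> \<D> \<Longrightarrow>
      uniform_limit K (\<lambda>n. deriv (f (r n))) (deriv h) sequentially"
    using bloch_unit_ball_derivs_compact[of f] f by auto
  define d where "d n z = f (r n) z - h z" for n z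
  have d: "d n \<in> bloch" for n
    unfolding d_def using bloch_diff f h(1) by blast
  have "bloch_seminorm (d n) \<le> 2" for n
  proof (rule bloch_seminorm_le)
    fix z assume z: "z \<in> \<D>"
    show "bloch_weight (d n) z \<le> 2"
      using bloch_weight_diff_le[of "f (r n)" h z] bloch_weight_le_norm[of "f (r n)" z]
        bloch_weight_le_norm[of h z] f[of "r n"] h z by (simp add: d_def[abs_def])
  qed
  moreover have "uniform_limit K (\<lambda>n. deriv (d n)) (\<lambda>_. 0) sequentially"
    if K: "compact K" "K \<subseteq> \<D>" for K
  proof -
    have "deriv (d n) z = deriv (f (r n)) z - deriv h z" if "z \<in> K" for n z
      unfolding d_def using deriv_diff_bloch f h(1) K(2) that by blast
    then show ?thesis
      using unif[OF K] by (simp add: uniform_limit_sequentially_iff dist_norm)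
  qed
  ultimately have "(\<lambda>n. bloch_norm (commutator (d n))) \<longlonglongrightarrow> 0"
    using commutator_norm_tendsto_0[OF assms] d by blast
  moreover have "bloch_norm (commutator (d n)) = bloch_dist ((\<sigma> \<circ> r) n) (commutator h)" for n
    using f[of "r n"] h(1)
    by (simp add: bloch_dist_def \<sigma> commutator_in_bloch commutator_diff d_def[abs_def])
  ultimately have "limitin bloch_topology (\<sigma> \<circ> r) (commutator h) sequentially"
    unfolding bloch.limitin_metric_dist_null
    using h(1) f by (auto simp: commutator_in_bloch \<sigma>)
  then show "\<exists>l r. l \<in> commutator ` ?U \<and> strict_mono r \<and>
      limitin bloch_topology (\<sigma> \<circ> r) l sequentially"
    using h r by blast
qed

lemma bloch_compact_commutator_if_vanishes:
  assumes "vanishes_as_modulus_to_1 \<phi> symbol"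
  shows "bloch_compact_operator commutator"
proof -
  let ?C = "commutator ` {f \<in> bloch. bloch_norm f \<le> 1}"
  have "compactin bloch_topology ?C"
    by (rule compactin_commutator_image[OF assms])
  then have "closedin bloch_topology ?C"
    using bloch.Hausdorff_space_mtopology compactin_imp_closedin by blast
  then show ?thesis
    unfolding bloch_compact_operator_def
    using \<open>compactin bloch_topology ?C\<close> bloch_linear_commutator by (simp add: closure_of_closedin)
qed

end

section \<open>Compactness of the commutator forces the vanishing condition\<close>

text \<open>The automorphism sending \<open>w\<close> to \<open>0\<close>, shifted to vanish at \<open>0\<close>; on the disk this is
  \<open>(1 - \<bar>w\<bar>\<^sup>2) z / (1 - cnj w z)\<close>. With value \<open>0\<close> at the origin its Bloch norm is its seminorm, which
  is \<open>1\<close> and is attained at \<open>w\<close>.\<close>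

definition peak_function :: "complex \<Rightarrow> complex \<Rightarrow> complex"
  where "peak_function w z = (if z \<in> \<D> then Moebius_function 0 w z + w else 0)"

lemma has_field_derivative_peak_function:
  assumes "w \<in> \<D>" "z \<in> \<D>"
  shows "(peak_function w has_field_derivative
           complex_of_real (1 - (cmod w)\<^sup>2) / (1 - cnj w * z)\<^sup>2) (at z)"
proof -
  have "((\<lambda>z. Moebius_function 0 w z + w) has_field_derivative
      complex_of_real (1 - (cmod w)\<^sup>2) / (1 - cnj w * z)\<^sup>2) (at z)"
    using DERIV_add[OF has_field_derivative_Moebius_function[OF assms] DERIV_const[of w]] by simp
  then show ?thesis
    by (rule has_field_derivative_transform_within_open[where S = \<D>])
      (use assms(2) in \<open>auto simp: peak_function_def\<close>)
qed

lemma cmod_one_minus_cnj_mult_ge: "1 - cmod w * cmod z \<le> cmod (1 - cnj w * z)"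
  using norm_triangle_ineq2[of 1 "cnj w * z"] by (simp add: norm_mult)

lemma bloch_weight_peak_function:
  assumes "w \<in> \<D>" "z \<in> \<D>"
  shows "bloch_weight (peak_function w) z =
    (1 - (cmod z)\<^sup>2) * (1 - (cmod w)\<^sup>2) / (cmod (1 - cnj w * z))\<^sup>2"
  using one_minus_norm_sq_pos[OF assms(1)]
  by (simp add: bloch_weight_def DERIV_imp_deriv[OF has_field_derivative_peak_function[OF assms]]
      norm_divide norm_power del: of_real_diff)

text \<open>Since \<open>\<bar>1 - cnj w z\<bar> \<ge> 1 - \<bar>w\<bar> \<bar>z\<bar>\<close>, the bound amounts to
  \<open>(1 - a\<^sup>2) (1 - b\<^sup>2) \<le> (1 - a b)\<^sup>2\<close>, that is, to \<open>0 \<le> (a - b)\<^sup>2\<close>.\<close>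

lemma bloch_weight_peak_function_le_1:
  assumes "w \<in> \<D>" "z \<in> \<D>"
  shows "bloch_weight (peak_function w) z \<le> 1"
proof -
  have "cmod w * cmod z < 1"
    using assms norm_mult_less[of w 1 z 1] by (simp add: norm_mult)
  then have "(1 - cmod w * cmod z)\<^sup>2 \<le> (cmod (1 - cnj w * z))\<^sup>2"
    using cmod_one_minus_cnj_mult_ge[of w z] by (intro power_mono) auto
  moreover have "(1 - (cmod z)\<^sup>2) * (1 - (cmod w)\<^sup>2) \<le> (1 - cmod w * cmod z)\<^sup>2"
    using zero_le_power2[of "cmod w - cmod z"] by (simp add: power2_eq_square algebra_simps)
  ultimately show ?thesis
    unfolding bloch_weight_peak_function[OF assms] by (intro divide_le_eq_1[THEN iffD2]) auto
qed

lemma bloch_weight_peak_function_self: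
  assumes "w \<in> \<D>"
  shows "bloch_weight (peak_function w) w = 1"
proof -
  have "cnj w * w = complex_of_real ((cmod w)\<^sup>2)"
    by (simp only: complex_norm_square mult.commute)
  then have "1 - cnj w * w = complex_of_real (1 - (cmod w)\<^sup>2)"
    by simp
  then have "cmod (1 - cnj w * w) = 1 - (cmod w)\<^sup>2"
    using one_minus_norm_sq_pos[OF assms] by (simp del: of_real_diff)
  then show ?thesis
    using one_minus_norm_sq_pos[OF assms]
    by (simp add: bloch_weight_peak_function[OF assms assms] power2_eq_square)
qed

lemma peak_function_in_unit_ball:
  assumes "w \<in> \<D>"
  shows "peak_function w \<in> bloch" "bloch_norm (peak_function w) \<le> 1"
proof -
  show "peak_function w \<in> bloch"
  proof (rule bloch_memI)
    show "peak_function w holomorphic_on \<D>"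
      by (rule holomorphic_on_diskI[OF has_field_derivative_peak_function[OF assms]])
  qed (use bloch_weight_peak_function_le_1[OF assms] in \<open>auto simp: peak_function_def\<close>)
  have "bloch_seminorm (peak_function w) \<le> 1"
    by (rule bloch_seminorm_le[OF bloch_weight_peak_function_le_1[OF assms]])
  then show "bloch_norm (peak_function w) \<le> 1"
    by (simp add: bloch_norm_def peak_function_def Moebius_function_simple)
qed

text \<open>For fixed \<open>u\<close> the denominator of the weight stays above \<open>(1 - \<bar>u\<bar>)\<^sup>2\<close>, while the factor
  \<open>1 - \<bar>w\<^sub>n\<bar>\<^sup>2\<close> in the numerator tends to \<open>0\<close>.\<close>

lemma bloch_weight_peak_function_tendsto_0:
  assumes w: "\<And>n. w n \<in> \<D>" "(\<lambda>n. cmod (w n)) \<longlonglongrightarrow> 1" and u: "u \<in> \<D>"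
  shows "(\<lambda>n. bloch_weight (peak_function (w n)) u) \<longlonglongrightarrow> 0"
proof (rule tendsto_sandwich[OF _ _ tendsto_const])
  have pos: "0 < 1 - cmod u"
    using u by simp
  let ?up = "\<lambda>n. (1 - (cmod u)\<^sup>2) * (1 - (cmod (w n))\<^sup>2) / (1 - cmod u)\<^sup>2"
  show "\<forall>\<^sub>F n in sequentially. 0 \<le> bloch_weight (peak_function (w n)) u"
    using bloch_weight_nonneg[OF u] by simp
  show "\<forall>\<^sub>F n in sequentially. bloch_weight (peak_function (w n)) u \<le> ?up n"
  proof (rule always_eventually, rule allI)
    fix n
    have "cmod (w n) * cmod u \<le> cmod u"
      using w(1)[of n] by (simp add: mult_left_le_one_le)
    then have "(1 - cmod u)\<^sup>2 \<le> (cmod (1 - cnj (w n) * u))\<^sup>2"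
      using cmod_one_minus_cnj_mult_ge[of "w n" u] pos by (intro power_mono) auto
    then show "bloch_weight (peak_function (w n)) u \<le> ?up n"
      unfolding bloch_weight_peak_function[OF w(1) u]
      using pos one_minus_norm_sq_pos[OF u] one_minus_norm_sq_pos[OF w(1)[of n]]
      by (intro frac_le mult_nonneg_nonneg) auto
  qed
  have "?up \<longlonglongrightarrow> (1 - (cmod u)\<^sup>2) * (1 - 1\<^sup>2) / (1 - cmod u)\<^sup>2"
    by (intro tendsto_intros w(2)) (use pos in auto)
  then show "?up \<longlonglongrightarrow> 0"
    by simp
qed

context disk_symbols
begin

text \<open>Peak functions at \<open>\<phi> z\<^sub>n\<close> detect the symbol at \<open>z\<^sub>n\<close>. Their images can only accumulate at functions with
  zero derivative, yet they keep a weight of at least \<open>\<epsilon>\<close> at \<open>z\<^sub>n\<close>.\<close>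

lemma vanishes_if_bloch_compact_commutator:
  assumes "bloch_compact_operator commutator"
  shows "vanishes_as_modulus_to_1 \<phi> symbol"
proof (rule ccontr)
  let ?T = "commutator ` {f \<in> bloch. bloch_norm f \<le> 1}"
  assume "\<not> ?thesis"
  then obtain \<epsilon> where \<epsilon>: "0 < \<epsilon>"
    and bad: "\<And>r. 0 < r \<Longrightarrow> r < 1 \<Longrightarrow> \<exists>z\<in>\<D>. r < cmod (\<phi> z) \<and> \<epsilon> \<le> symbol z"
    unfolding vanishes_as_modulus_to_1_def by (force simp: symbol_nonneg not_less)
  have "\<forall>n. \<exists>z\<in>\<D>. 1 - 1 / real (n + 2) < cmod (\<phi> z) \<and> \<epsilon> \<le> symbol z"
    by (intro allI bad) (auto simp: field_simps)
  then obtain z where z: "\<And>n. z n \<in> \<D>" "\<And>n. 1 - 1 / real (n + 2) < cmod (\<phi> (z n))"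
    "\<And>n. \<epsilon> \<le> symbol (z n)"
    by metis
  define w where "w n = \<phi> (z n)" for n
  have w: "w n \<in> \<D>" for n
    using z(1) selfmap_in by (simp add: w_def del: mem_ball)
  have lim_w: "(\<lambda>n. cmod (w n)) \<longlonglongrightarrow> 1"
  proof (rule tendsto_sandwich[OF _ _ _ tendsto_const])
    show "\<forall>\<^sub>F n in sequentially. 1 - 1 / real (n + 2) \<le> cmod (w n)"
      using z(2) by (auto simp: w_def intro!: always_eventually less_imp_le)
    show "\<forall>\<^sub>F n in sequentially. cmod (w n) \<le> 1"
      using w by (auto intro!: always_eventually less_imp_le)
    have "(\<lambda>n. 1 - 1 / real (n + 2)) \<longlonglongrightarrow> 1 - 0"
      by (intro tendsto_diff tendsto_const LIMSEQ_ignore_initial_segment[OF lim_1_over_n])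
    then show "(\<lambda>n. 1 - 1 / real (n + 2)) \<longlonglongrightarrow> 1"
      by simp
  qed
  define p where "p n = peak_function (w n)" for n
  have p: "p n \<in> bloch" "bloch_norm (p n) \<le> 1" for n
    using peak_function_in_unit_ball[OF w] by (simp_all add: p_def)
  define \<sigma> where "\<sigma> n = commutator (p n)" for n
  have \<sigma>_bloch: "\<sigma> n \<in> bloch" for n
    using commutator_in_bloch p(1) by (simp add: \<sigma>_def)
  have "?T \<subseteq> topspace bloch_topology"
    using commutator_in_bloch by auto
  then have "range \<sigma> \<subseteq> bloch_topology closure_of ?T"
    using closure_of_subset p unfolding \<sigma>_def by blast
  then obtain F r where r: "strict_mono (r :: nat \<Rightarrow> nat)"
    and "limitin bloch_topology (\<sigma> \<circ> r) F sequentially"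
    using assms unfolding bloch_compact_operator_def bloch.compactin_sequentially by meson
  then have F: "F \<in> bloch" and dist: "(\<lambda>n. bloch_dist (\<sigma> (r n)) F) \<longlonglongrightarrow> 0"
    unfolding bloch.limitin_metric_dist_null by auto
  have le_dist: "bloch_weight (\<lambda>z. \<sigma> n z - F z) u \<le> bloch_dist (\<sigma> n) F" if "u \<in> \<D>" for n u
    using bloch_weight_le_norm[OF bloch_diff[OF \<sigma>_bloch F] that] \<sigma>_bloch F
    by (simp add: bloch_dist_def)
  have weight_\<sigma>: "bloch_weight (\<sigma> n) u = symbol u * bloch_weight (p n) (\<phi> u)" if "u \<in> \<D>" for n u
    unfolding \<sigma>_def by (rule bloch_weight_commutator[OF bloch_holomorphic[OF p(1)] that])
  \<comment> \<open>Weights at a fixed point pass to the Bloch limit, and those of the images tend to \<open>0\<close> there.\<close>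
  have F': "deriv F u = 0" if u: "u \<in> \<D>" for u
  proof -
    have "bloch_weight F u \<le> bloch_dist (\<sigma> (r n)) F + symbol u * bloch_weight (p (r n)) (\<phi> u)" for n
      using bloch_weight_diff_le[OF \<sigma>_bloch bloch_diff[OF \<sigma>_bloch F] u, of "r n" "r n"]
        le_dist[OF u, of "r n"] by (simp add: weight_\<sigma>[OF u])
    moreover have "(\<lambda>n. bloch_weight (p (r n)) (\<phi> u)) \<longlonglongrightarrow> 0"
      using LIMSEQ_subseq_LIMSEQ[OF bloch_weight_peak_function_tendsto_0[OF w lim_w selfmap_in[OF u]] r]
      by (simp add: p_def o_def)
    then have "(\<lambda>n. bloch_dist (\<sigma> (r n)) F + symbol u * bloch_weight (p (r n)) (\<phi> u)) \<longlonglongrightarrow>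
        0 + symbol u * 0"
      by (intro tendsto_intros dist)
    ultimately have "bloch_weight F u \<le> 0 + symbol u * 0"
      by (intro LIMSEQ_le_const) auto
    then show ?thesis
      using one_minus_norm_sq_pos[OF u] unfolding bloch_weight_def
      by (simp add: mult_le_0_iff)
  qed
  have "\<epsilon> \<le> bloch_dist (\<sigma> (r n)) F" for n
  proof -
    let ?z = "z (r n)"
    have "\<epsilon> \<le> bloch_weight (\<sigma> (r n)) ?z"
      using z(3)[of "r n"] weight_\<sigma>[OF z(1)] bloch_weight_peak_function_self[OF w]
      by (simp add: p_def w_def)
    also have "\<dots> = bloch_weight (\<lambda>z. \<sigma> (r n) z - F z) ?z"
      unfolding bloch_weight_def deriv_diff_bloch[OF \<sigma>_bloch F z(1)] F'[OF z(1)] by simp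
    also have "\<dots> \<le> bloch_dist (\<sigma> (r n)) F"
      by (rule le_dist[OF z(1)])
    finally show ?thesis .
  qed
  then have "\<epsilon> \<le> 0"
    by (intro LIMSEQ_le_const[OF dist]) auto
  with \<epsilon> show False
    by simp
qed

end

theorem theorem3p2:
  fixes \<phi> g :: "complex \<Rightarrow> complex"
  assumes "\<phi> \<in> disk_selfmaps" and "g \<in> H_infinity"
  shows "essentially_commutative_on_bloch (composition_op \<phi>) (integral_op g) \<longleftrightarrow>
    vanishes_as_modulus_to_1 \<phi> (\<lambda>z. cmod (hyperbolic_deriv \<phi> z) * cmod (g (\<phi> z) - g z))"
proof -
  interpret disk_symbols \<phi> g
    using assms by unfold_locales
  have "essentially_commutative_on_bloch (composition_op \<phi>) (integral_op g) \<longleftrightarrow>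
      bloch_compact_operator commutator"
    by (simp add: essentially_commutative_on_bloch_def commutator_def[abs_def])
  also have "\<dots> \<longleftrightarrow> vanishes_as_modulus_to_1 \<phi> symbol"
    using bloch_compact_commutator_if_vanishes vanishes_if_bloch_compact_commutator by blast
  finally show ?thesis
    by (simp add: symbol_def[abs_def])
qed

end
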